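(* Let $P_\theta(w\mid x)$ denote a base model distribution over tokens $w\in\mathcal{V}$ for a fixed context $x$. For any target distribution $Q(w\mid x)$ on $\mathcal{V}$ satisfying $$Q(w\mid x)>0\ \Rightarrow\ P_\theta(w\mid x)>0,$$ there exists a logit-level inference policy $\mathcal{I}$ such that $$P_{\theta,\mathcal{I}}(w\mid x)=Q(w\mid x).$$ Consequently, the served distribution $Q$ is observationally compatible both with: (a) a base model $P_\theta$ combined with a non-trivial inference policy $\mathcal{I}$; and (b) a different model $P_{\theta'}=Q$ combined with the identity inference policy. Black-box observations of the served distribution alone therefore cannot uniquely identify whether the observed behavior originates from model parameters or runtime steering.
   Context: $\mathcal{V}$ is a discrete vocabulary of tokens. A language model with parameters (weights) $\theta$ produces, for the fixed context $x$, a logit vector $z\in\mathbb{R}^{|\mathcal{V}|}$, and defines the distribution $$P_\theta(w\mid x)=\frac{\exp(z(w))}{\sum_{v\in\mathcal{V}}\exp(z(v))}.$$ A logit-level inference policy $\mathcal{I}$ transforms the logits before sampling, without changing $\theta$, by $$z'(w)=z(w)+\lambda s(w),$$ where $s:\mathcal{V}\to\mathbb{R}$ is an external scoring function (which may depend on the context, on information about the user or interaction state, and on an external steering objective) and $\lambda\ge 0$ is the intervention magnitude. The resulting served distribution is $$P_{\theta,\mathcal{I}}(w\mid x)\propto P_\theta(w\mid x)\exp(\lambda s(w)).$$ The identity inference policy is the identity transformation of the logits, $z'=z$; a non-trivial policy is one that is not the identity. A deployed system consists of a model together with an inference policy. The served distribution $Q$ is observationally compatible with a system if that system exposes $Q$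 as its observable (served) distribution. A black-box observer sees only the served distribution, not its decomposition into model and policy.
   Formalization: Logits and scores may also take the value −∞ (token masking, exp(−∞)=0), since with real logits and scores every served distribution has full support and a target Q with zeros could not be served; "different model" means a different logit vector. *)

theory Defs
  imports "HOL-Probability.Probability_Mass_Function" "HOL-Library.Extended_Real"
begin

text \<open>
  Logits and scores take values in the reals extended by minus infinity, with
  \<open>exp (-\<infinity>) = 0\<close> (token masking). With real logits and scores every served distribution
  has full support, so a target distribution with zeros could not be served at all, and the
  support condition on the target would be vacuous. Lemmas \<open>model_dist_real\<close> and
  \<open>score_finite\<close> below relate this to the real-valued setting.
\<close>

definition exp_ext :: "ereal \<Rightarrow> real" where
  "exp_ext x = (if x = -\<infinity> then 0 else exp (real_of_ereal x))"

text \<open>The vocabulary is a finite type; the context is fixed, so a model is given by its logits.\<close>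

type_synonym 'v logits = "'v \<Rightarrow> ereal"

definition is_logits :: "('v::finite) logits \<Rightarrow> bool" where
  "is_logits z \<longleftrightarrow> (\<forall>w. z w \<noteq> \<infinity>) \<and> (\<exists>w. z w \<noteq> -\<infinity>)"

definition model_dist :: "('v::finite) logits \<Rightarrow> 'v \<Rightarrow> real" where
  "model_dist z w = exp_ext (z w) / (\<Sum>v\<in>UNIV. exp_ext (z v))"

datatype 'v policy = Policy (magnitude: real) (score: "'v \<Rightarrow> ereal")

definition is_policy :: "('v::finite) policy \<Rightarrow> bool" where
  "is_policy I \<longleftrightarrow> magnitude I \<ge> 0 \<and> (\<forall>w. score I w \<noteq> \<infinity>)"

definition steer :: "('v::finite) policy \<Rightarrow> 'v logits \<Rightarrow> 'v logits" where
  "steer I z = (\<lambda>w. z w + ereal (magnitude I) * score I w)"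

definition served_dist :: "('v::finite) logits \<Rightarrow> 'v policy \<Rightarrow> 'v \<Rightarrow> real" where
  "served_dist z I = model_dist (steer I z)"

definition identity_policy :: "('v::finite) policy" where
  "identity_policy = Policy 0 (\<lambda>_. 0)"

definition non_trivial :: "('v::finite) policy \<Rightarrow> bool" where
  "non_trivial I \<longleftrightarrow> (\<exists>z. is_logits z \<and> steer I z \<noteq> z)"

datatype 'v deployed = Deployed (model: "'v logits") (policy: "'v policy")

text \<open>The last conjunct says that the policy does not mask every token.\<close>

definition is_deployed :: "('v::finite) deployed \<Rightarrow> bool" where
  "is_deployed S \<longleftrightarrow>
     is_logits (model S) \<and> is_policy (policy S) \<and> is_logits (steer (policy S) (model S))"

definition observable :: "('v::finite) deployed \<Rightarrow> 'v \<Rightarrow> real" where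
  "observable S = served_dist (model S) (policy S)"

definition observationally_compatible :: "('v::finite) pmf \<Rightarrow> 'v deployed \<Rightarrow> bool" where
  "observationally_compatible Q S \<longleftrightarrow> is_deployed S \<and> observable S = pmf Q"

text \<open>
  A black-box attribution maps an observed distribution to a verdict: \<open>True\<close> for runtime
  steering, \<open>False\<close> for the model parameters alone. The origin of \<open>Q\<close> is identifiable if
  some attribution is correct on every deployed system that exposes \<open>Q\<close>.
\<close>

definition origin_identifiable :: "('v::finite) pmf \<Rightarrow> bool" where
  "origin_identifiable Q \<longleftrightarrow>
     (\<exists>attribution :: ('v \<Rightarrow> real) \<Rightarrow> bool.
        \<forall>S. observationally_compatible Q S \<longrightarrow>
          (attribution (observable S) \<longleftrightarrow> non_trivial (policy S)))"

lemma model_dist_real: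
  "model_dist (\<lambda>w. ereal (z w)) w = exp (z w) / (\<Sum>v\<in>UNIV. exp (z v))"
  by (simp add: model_dist_def exp_ext_def)

lemma exp_ext_nonneg: "exp_ext x \<ge> 0"
  by (simp add: exp_ext_def)

lemma exp_ext_add: "x \<noteq> \<infinity> \<Longrightarrow> y \<noteq> \<infinity> \<Longrightarrow> exp_ext (x + y) = exp_ext x * exp_ext y"
  by (cases x; cases y) (auto simp: exp_ext_def exp_add)

lemma normalizer_pos:
  assumes "is_logits z"
  shows "(\<Sum>v\<in>UNIV. exp_ext (z v)) > 0"
proof -
  obtain w where "z w \<noteq> -\<infinity>" using assms by (auto simp: is_logits_def)
  then have "exp_ext (z w) > 0" by (simp add: exp_ext_def)
  then show ?thesis by (intro sum_pos2[where i = w]) (auto simp: exp_ext_nonneg)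
qed

lemma model_dist_eq_0_iff:
  assumes "is_logits z"
  shows "model_dist z w = 0 \<longleftrightarrow> z w = -\<infinity>"
  using normalizer_pos[OF assms] by (auto simp: model_dist_def exp_ext_def)

lemma scaled_score_finite: "is_policy I \<Longrightarrow> ereal (magnitude I) * score I w \<noteq> \<infinity>"
  by (cases "score I w") (auto simp: is_policy_def dest: spec[of _ w])

lemma served_dist_proportional:
  assumes "is_logits z" "is_policy I"
  shows "served_dist z I w =
    model_dist z w * exp_ext (ereal (magnitude I) * score I w) /
      (\<Sum>v\<in>UNIV. model_dist z v * exp_ext (ereal (magnitude I) * score I v))"
proof -
  let ?Z = "\<Sum>v\<in>UNIV. exp_ext (z v)"
  let ?e = "\<lambda>v. exp_ext (ereal (magnitude I) * score I v)"
  have *: "exp_ext (steer I z v) = ?Z * (model_dist z v * ?e v)" for v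
    using normalizer_pos[OF assms(1)] assms(1) scaled_score_finite[OF assms(2)]
    by (simp add: steer_def model_dist_def exp_ext_add is_logits_def)
  show ?thesis
    using normalizer_pos[OF assms(1)]
    by (simp add: served_dist_def model_dist_def[of "steer I z"] * flip: sum_distrib_left)
qed

lemma steer_identity_policy: "steer identity_policy z = z"
  by (simp add: steer_def identity_policy_def flip: zero_ereal_def)

lemma identity_policy_trivial: "\<not> non_trivial identity_policy"
  by (simp add: non_trivial_def steer_identity_policy)

text \<open>Masking is never used on the support: a non-trivial policy serving \<open>Q\<close> has real scores there.\<close>

lemma score_finite:
  assumes "observationally_compatible Q S" "non_trivial (policy S)" "pmf Q w > 0"
  shows "\<bar>score (policy S) w\<bar> \<noteq> \<infinity>"
proof -
  let ?I = "policy S"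
  have I: "is_policy ?I" and L: "is_logits (steer ?I (model S))"
    and Q: "model_dist (steer ?I (model S)) w = pmf Q w"
    using assms(1)
    by (auto simp: observationally_compatible_def is_deployed_def observable_def served_dist_def)
  have "magnitude ?I \<noteq> 0"
    using assms(2) by (auto simp: non_trivial_def steer_def simp flip: zero_ereal_def)
  then have "magnitude ?I > 0" using I by (simp add: is_policy_def)
  moreover have "steer ?I (model S) w \<noteq> -\<infinity>"
    using model_dist_eq_0_iff[OF L] Q assms(3) by (metis less_irrefl)
  moreover have "score ?I w \<noteq> \<infinity>" using I by (simp add: is_policy_def)
  moreover have "model S w \<noteq> \<infinity>"
    using assms(1) by (simp add: observationally_compatible_def is_deployed_def is_logits_def)
  ultimately show ?thesis
    by (cases "score ?I w"; cases "model S w") (auto simp: steer_def)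
qed

end

theory Submission
  imports Defs
begin

text \<open>
  The logits \<open>ln Q + c\<close> have softmax \<open>Q\<close> for every real \<open>c\<close>, and the score \<open>ln Q + c - \<theta>\<close> steers
  \<open>\<theta>\<close> to them. At a token of the support of \<open>Q\<close>, one of any two different shifts \<open>c\<close> gives a nonzero
  score, hence a non-trivial policy, and one of them gives logits different from \<open>\<theta>\<close>.
\<close>

definition log_logits :: "('v::finite) pmf \<Rightarrow> real \<Rightarrow> 'v logits" where
  "log_logits Q c w = (if pmf Q w = 0 then -\<infinity> else ereal (ln (pmf Q w) + c))"

lemma exp_ext_log_logits: "exp_ext (log_logits Q c w) = pmf Q w * exp c"
  using pmf_pos[of Q w] by (auto simp: log_logits_def exp_ext_def exp_add)

lemma is_logits_log_logits: "is_logits (log_logits Q c)"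
proof -
  obtain w where "w \<in> set_pmf Q" using set_pmf_not_empty by fast
  then show ?thesis by (auto simp: is_logits_def log_logits_def set_pmf_iff)
qed

lemma model_dist_log_logits: "model_dist (log_logits Q c) = pmf Q"
  by (rule ext) (simp add: model_dist_def exp_ext_log_logits sum_pmf_eq_1 flip: sum_distrib_right)

text \<open>
  Where \<open>\<theta>\<close> is \<open>-\<infinity>\<close>, \<open>real_of_ereal\<close> returns 0 and so avoids the value \<open>-\<infinity> - (-\<infinity>) = \<infinity>\<close>.
\<close>

definition steering_policy :: "('v::finite) logits \<Rightarrow> 'v pmf \<Rightarrow> real \<Rightarrow> 'v policy" where
  "steering_policy \<theta> Q c = Policy 1 (\<lambda>w. log_logits Q c w - ereal (real_of_ereal (\<theta> w)))"

lemma is_policy_steering_policy: "is_policy (steering_policy \<theta> Q c)"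
  by (simp add: is_policy_def steering_policy_def log_logits_def)

text \<open>Off the support of \<open>Q\<close> the score is -\<infinity>, which masks the token
  whether or not \<open>\<theta>\<close> does. On the support, the second assumption rules out
  \<open>\<theta> w = -\<infinity>\<close>, so \<open>\<theta> w\<close> is real and
  cancels.\<close>

lemma steer_steering_policy:
  assumes "is_logits \<theta>" and "\<And>w. pmf Q w > 0 \<Longrightarrow> model_dist \<theta> w > 0"
  shows "steer (steering_policy \<theta> Q c) \<theta> = log_logits Q c"
proof
  fix w
  have "\<theta> w \<noteq> \<infinity>" using assms(1) by (simp add: is_logits_def)
  moreover have "\<theta> w \<noteq> -\<infinity>" if "pmf Q w \<noteq> 0"
    using assms(2)[of w] that model_dist_eq_0_iff[OF assms(1)] pmf_nonneg[of Q w]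
    by (metis less_irrefl order_le_less)
  ultimately show "steer (steering_policy \<theta> Q c) \<theta> w = log_logits Q c w"
    by (cases "\<theta> w")
      (auto simp: steer_def steering_policy_def log_logits_def simp flip: one_ereal_def)
qed

lemma compatible_steering_policy:
  assumes "is_logits \<theta>" and "\<And>w. pmf Q w > 0 \<Longrightarrow> model_dist \<theta> w > 0"
  shows "observationally_compatible Q (Deployed \<theta> (steering_policy \<theta> Q c))"
  using steer_steering_policy[OF assms] assms(1)
  by (simp add: observationally_compatible_def is_deployed_def observable_def served_dist_def
      is_policy_steering_policy is_logits_log_logits model_dist_log_logits)

lemma compatible_identity_policy:
  "observationally_compatible Q (Deployed (log_logits Q c) identity_policy)"
proof -
  have "is_policy (identity_policy :: 'a policy)"
    by (simp add: is_policy_def identity_policy_def)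
  then show ?thesis
    by (simp add: observationally_compatible_def is_deployed_def observable_def served_dist_def
        steer_identity_policy is_logits_log_logits model_dist_log_logits)
qed

text \<open>Needed even when \<open>\<theta>\<close> itself has softmax \<open>Q\<close>: shifts 0
  and 1 give different logits, so at most one of them is \<open>\<theta>\<close>.\<close>

lemma ex_log_logits_neq: "\<exists>c. log_logits Q c \<noteq> \<theta>"
proof -
  obtain w where "w \<in> set_pmf Q" using set_pmf_not_empty by fast
  then have "log_logits Q 0 w \<noteq> log_logits Q 1 w" by (simp add: log_logits_def set_pmf_iff)
  then show ?thesis by metis
qed

lemma ex_non_trivial_steering_policy: "\<exists>c. non_trivial (steering_policy \<theta> Q c)"
proof -
  obtain w where w: "w \<in> set_pmf Q" using set_pmf_not_empty by fast
  \<comment> \<open>This shift makes the score at \<open>w\<close> equal to 1. Non-triviality may be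
    witnessed at any logits; at zero logits, steering with magnitude 1 returns the score
    itself.\<close>
  define c where "c = real_of_ereal (\<theta> w) - ln (pmf Q w) + 1"
  have "steer (steering_policy \<theta> Q c) (\<lambda>_. 0) w \<noteq> 0"
    using w by (simp add: steer_def steering_policy_def log_logits_def set_pmf_iff c_def)
  moreover have "is_logits (\<lambda>_::'a. 0)" by (simp add: is_logits_def)
  ultimately show ?thesis unfolding non_trivial_def by metis
qed

text \<open>An attribution receives only the observable, which is \<open>pmf Q\<close> for both
  systems, so it gives one verdict where two opposite ones are required.\<close>

lemma not_origin_identifiable:
  assumes "observationally_compatible Q S" "non_trivial (policy S)"
    and "observationally_compatible Q T" "\<not> non_trivial (policy T)"
  shows "\<not> origin_identifiable Q"
  using assms unfolding origin_identifiable_def observationally_compatible_def by metis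

theorem proposition1:
  fixes \<theta> :: "('v::finite) logits" and Q :: "'v pmf"
  assumes "is_logits \<theta>"
    and "\<And>w. pmf Q w > 0 \<Longrightarrow> model_dist \<theta> w > 0"
  shows "(\<exists>I. is_policy I \<and> (\<forall>w. served_dist \<theta> I w = pmf Q w))
    \<and> (\<exists>I. non_trivial I \<and> observationally_compatible Q (Deployed \<theta> I))
    \<and> (\<exists>\<theta>'. \<theta>' \<noteq> \<theta> \<and> model_dist \<theta>' = pmf Q
          \<and> observationally_compatible Q (Deployed \<theta>' identity_policy))
    \<and> \<not> origin_identifiable Q"
proof -
  obtain c where nt: "non_trivial (steering_policy \<theta> Q c)"
    using ex_non_trivial_steering_policy by blast
  obtain d where "log_logits Q d \<noteq> \<theta>" using ex_log_logits_neq by blast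
  moreover note compat = compatible_steering_policy[OF assms, of Q c]
  moreover have "served_dist \<theta> (steering_policy \<theta> Q c) w = pmf Q w" for w
    using compat by (simp add: observationally_compatible_def observable_def)
  \<comment> \<open>The conflicting pair: \<open>\<theta>\<close> steered to \<open>Q\<close>, and
    logits of \<open>Q\<close> served unchanged.\<close>
  moreover have "\<not> origin_identifiable Q"
    using not_origin_identifiable[OF compat _ compatible_identity_policy] nt
    by (simp add: identity_policy_trivial)
  ultimately show ?thesis
    using nt is_policy_steering_policy model_dist_log_logits compatible_identity_policy by blast
qed

end
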